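(* Let $(X,R,\tau)$ be a GCOTS. Suppose $\pi:G\times X\to X$ is a separately continuous action by COP maps of a semitopological group $G$. Then the action map $\pi$ is jointly continuous. Similarly, if $(X,\leq,\tau)$ is a GLOTS and $\pi:G\times X\to X$ is a separately continuous action of a semitopological group $G$ by linear order preserving maps, then $\pi$ is jointly continuous.
   Context: A circular order on a set $X$ is a ternary relation $R\subseteq X^3$ (write $[a,b,c]$ for $(a,b,c)\in R$) satisfying: cyclicity ($[a,b,c]\Rightarrow[b,c,a]$); asymmetry ($[a,b,c]\Rightarrow (c,b,a)\notin R$); transitivity ($[a,b,c]$ and $[a,c,d]$ imply $[a,b,d]$); totality (if $a,b,c$ are distinct then $[a,b,c]$ or $[a,c,b]$). Put $(a,b)_R:=\{x\in X:[a,x,b]\}$ and $[a,b]_R:=(a,b)_R\cup\{a,b\}$. The interval topology $\lambda_R$ is the topology on $X$ with base $\{X\setminus[a,b]_R: a,b\in X\}\cup\{X\}$. A GCOTS is a triple $(X,R,\tau)$ with $R$ a circular order and $\tau$ a topology on $X$ such that there are a circularly ordered set $(Y,R_Y)$ and an injection $i:X\to Y$ which is a topological embedding of $(X,\tau)$ into $(Y,\lambda_{R_Y})$ and satisfies $[a,b,c]_R\iff[i(a),i(b),i(c)]_{R_Y}$. A GLOTS $(X,\leq,\tau)$ is defined in the same way with linear orders and their interval topologies (generated by open rays). A map $f:X_1\to X_2$ of circularly ordered sets is COP if: (COP1) whenever $[a,b,c]$ in $X_1$ and $f(a),f(b),f(c)$ are pairwise distinct, then $[f(a),f(b),f(c)]$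 in $X_2$; (COP2) if $f(x)=f(y)$ then $f$ is constant on one of the closed intervals $[x,y]$, $[y,x]$. A map between linearly ordered sets is linear order preserving if $x\leq x'$ implies $f(x)\leq f(x')$. An action is COP (LOP) if every translation $x\mapsto gx$ is COP (resp. linear order preserving). A semitopological group is a group with a (Hausdorff) topology for which multiplication is separately continuous. Separate continuity of the action: all translations $X\to X$, $x\mapsto gx$, and all orbit maps $G\to X$, $g\mapsto gx$, are continuous. *)

theory Defs
  imports "HOL-Analysis.Analysis" "HOL-Algebra.Group_Action"
begin

section \<open>Circular orders\<close>

definition circular_order_on :: "'a set \<Rightarrow> ('a \<times> 'a \<times> 'a) set \<Rightarrow> bool" where
  "circular_order_on X R \<longleftrightarrow>
     R \<subseteq> X \<times> X \<times> X \<and>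
     (\<forall>a b c. (a, b, c) \<in> R \<longrightarrow> (b, c, a) \<in> R) \<and>
     (\<forall>a b c. (a, b, c) \<in> R \<longrightarrow> (c, b, a) \<notin> R) \<and>
     (\<forall>a b c d. (a, b, c) \<in> R \<and> (a, c, d) \<in> R \<longrightarrow> (a, b, d) \<in> R) \<and>
     (\<forall>a\<in>X. \<forall>b\<in>X. \<forall>c\<in>X. a \<noteq> b \<and> b \<noteq> c \<and> a \<noteq> c \<longrightarrow> (a, b, c) \<in> R \<or> (a, c, b) \<in> R)"

definition circ_open_interval :: "('a \<times> 'a \<times> 'a) set \<Rightarrow> 'a \<Rightarrow> 'a \<Rightarrow> 'a set" where
  "circ_open_interval R a b = {x. (a, x, b) \<in> R}"

definition circ_closed_interval :: "('a \<times> 'a \<times> 'a) set \<Rightarrow> 'a \<Rightarrow> 'a \<Rightarrow> 'a set" where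
  "circ_closed_interval R a b = circ_open_interval R a b \<union> {a, b}"

definition circ_base :: "'a set \<Rightarrow> ('a \<times> 'a \<times> 'a) set \<Rightarrow> 'a set set" where
  "circ_base X R = {X - circ_closed_interval R a b | a b. a \<in> X \<and> b \<in> X} \<union> {X}"

definition circ_topology :: "'a set \<Rightarrow> ('a \<times> 'a \<times> 'a) set \<Rightarrow> 'a topology" where
  "circ_topology X R = topology (arbitrary union_of (\<lambda>U. U \<in> circ_base X R))"

text \<open>
  The family \<open>circ_base X R\<close> really is a base of a topology on \<open>X\<close>, so the value of the
  total function \<^const>\<open>topology\<close> above is the intended one.
\<close>

lemma circ_base_Int:
  assumes R: "circular_order_on X R"
    and U: "U \<in> circ_base X R" and V: "V \<in> circ_base X R" and x: "x \<in> U \<inter> V"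
  shows "\<exists>W\<in>circ_base X R. x \<in> W \<and> W \<subseteq> U \<inter> V"
proof (cases "U = X \<or> V = X")
  case True
  moreover have "U \<subseteq> X" "V \<subseteq> X"
    using U V by (auto simp: circ_base_def)
  ultimately show ?thesis
    using U V x by blast
next
  case False
  note R' = R[unfolded circular_order_on_def]
  note R2 = R'[THEN conjunct2] note R3 = R2[THEN conjunct2] note R4 = R3[THEN conjunct2]
  have cyc: "(b, c, a) \<in> R" if "(a, b, c) \<in> R" for a b c
    using R2[THEN conjunct1] that by iprover
  have asym: "(c, b, a) \<notin> R" if "(a, b, c) \<in> R" for a b c
    using R3[THEN conjunct1] that by iprover
  have trans: "(a, b, d) \<in> R" if "(a, b, c) \<in> R" "(a, c, d) \<in> R" for a b c d
    using R4[THEN conjunct1] that by iprover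
  have tot: "(a, b, c) \<in> R \<or> (a, c, b) \<in> R"
    if "a \<in> X" "b \<in> X" "c \<in> X" "a \<noteq> b" "b \<noteq> c" "a \<noteq> c" for a b c
    using R4[THEN conjunct2] that by blast
  obtain a b where ab: "a \<in> X" "b \<in> X" "U = X - circ_closed_interval R a b"
    using U False by (auto simp: circ_base_def)
  obtain c d where cd: "c \<in> X" "d \<in> X" "V = X - circ_closed_interval R c d"
    using V False by (auto simp: circ_base_def)
  have xX: "x \<in> X"
    using x ab by auto
  txt \<open>Cutting the circle at \<open>x\<close> gives a linear order on \<open>X - {x}\<close>.\<close>
  define le where "le = (\<lambda>y z. y = z \<or> (x, y, z) \<in> R)"
  have le_trans: "le p r" if "le p q" "le q r" for p q r
    using that trans[of x p q r] unfolding le_def by auto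
  have le_total: "le p q \<or> le q p" if "p \<in> X - {x}" "q \<in> X - {x}" for p q
    using that tot[of x p q] xX unfolding le_def by auto
  have ival: "le p q \<longleftrightarrow> x \<notin> circ_closed_interval R p q"
    if ival_ne: "p \<in> X - {x}" "q \<in> X - {x}" for p q
  proof -
    have "(p, p, x) \<notin> R" "(p, x, p) \<notin> R"
      using asym[of p x p] asym[of x p p] cyc[of p p x] by auto
    moreover have "(x, p, q) \<in> R \<longleftrightarrow> (p, x, q) \<notin> R" if "p \<noteq> q"
      using tot[of x p q] that ival_ne(1,2) xX cyc[of p x q] cyc[of x q p] asym[of x p q]
        cyc[of q p x] cyc[of x q p] by auto
    ultimately show ?thesis
      using ival_ne by (auto simp: le_def circ_closed_interval_def circ_open_interval_def)
  qed
  have mem: "y \<in> circ_closed_interval R p q \<longleftrightarrow> y \<noteq> x \<and> le p y \<and> le y q"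
    if "p \<in> X - {x}" "q \<in> X - {x}" "le p q" "y \<in> X" for p q y
  proof (cases "y = p \<or> y = q \<or> y = x")
    case True
    then show ?thesis
      using that ival[of p q] by (auto simp: circ_closed_interval_def le_def)
  next
    case False
    have "(p, y, q) \<in> R \<longleftrightarrow> (x, p, y) \<in> R \<and> (x, y, q) \<in> R"
    proof
      assume *: "(p, y, q) \<in> R"
      then have "p \<noteq> q"
        using asym by blast
      then have xpq: "(x, p, q) \<in> R"
        using \<open>le p q\<close> by (simp add: le_def)
      have "(q, x, p) \<in> R" "(q, p, y) \<in> R"
        by (rule cyc[OF cyc[OF xpq]], rule cyc[OF cyc[OF *]])
      then have "(q, x, y) \<in> R"
        by (rule trans)
      moreover have "(p, y, x) \<in> R"
        by (rule trans[OF * cyc[OF xpq]])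
      ultimately show "(x, p, y) \<in> R \<and> (x, y, q) \<in> R"
        using cyc[of q x y] cyc[of p y x] cyc[of y x p] by simp
    next
      assume "(x, p, y) \<in> R \<and> (x, y, q) \<in> R"
      then have "(y, x, p) \<in> R" "(y, q, x) \<in> R"
        using cyc[of x p y] cyc[of p y x] cyc[of x y q] by simp_all
      then have "(y, q, p) \<in> R"
        by (meson trans)
      then show "(p, y, q) \<in> R"
        using cyc[of y q p] cyc[of q p y] by simp
    qed
    then show ?thesis
      using False by (auto simp: circ_closed_interval_def circ_open_interval_def le_def)
  qed
  have ne: "a \<in> X - {x}" "b \<in> X - {x}" "c \<in> X - {x}" "d \<in> X - {x}"
    using ab cd x by (auto simp: circ_closed_interval_def)
  have ab': "le a b" and cd': "le c d"
    using ival ne ab cd x by auto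
  obtain e where e: "e \<in> X - {x}" "le e a" "le e c"
    using le_total[OF ne(1,3)] ne(1,3) that[of a] that[of c] by (auto simp: le_def)
  obtain f where f: "f \<in> X - {x}" "le b f" "le d f"
    using le_total[OF ne(2,4)] ne(2,4) that[of b] that[of d] by (auto simp: le_def)
  have ef: "le e f"
    by (rule le_trans[OF le_trans[OF e(2) ab'] f(2)])
  let ?W = "X - circ_closed_interval R e f"
  have "x \<notin> circ_closed_interval R e f"
    using ival[OF e(1) f(1)] ef by simp
  then have "x \<in> ?W"
    using xX by simp
  moreover have "?W \<subseteq> U \<inter> V"
  proof
    fix y
    assume y: "y \<in> ?W"
    then have yX: "y \<in> X"
      by simp
    have nef: "\<not> (y \<noteq> x \<and> le e y \<and> le y f)"
      using y mem[OF e(1) f(1) ef yX] by simp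
    have "y \<notin> circ_closed_interval R a b"
      using mem[OF ne(1,2) ab' yX] nef le_trans[OF e(2), of y] le_trans[OF _ f(2), of y] by argo
    moreover have "y \<notin> circ_closed_interval R c d"
      using mem[OF ne(3,4) cd' yX] nef le_trans[OF e(3), of y] le_trans[OF _ f(3), of y] by argo
    ultimately show "y \<in> U \<inter> V"
      using ab(3) cd(3) yX by simp
  qed
  moreover have "?W \<in> circ_base X R"
    using e(1) f(1) by (auto simp: circ_base_def)
  ultimately show ?thesis
    by (intro bexI[of _ ?W]) simp_all
qed

lemma openin_circ_topology:
  assumes "circular_order_on X R"
  shows "openin (circ_topology X R) = arbitrary union_of (\<lambda>U. U \<in> circ_base X R)"
proof -
  have "(arbitrary union_of (\<lambda>U. U \<in> circ_base X R)) (S \<inter> T)"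
    if "S \<in> circ_base X R" "T \<in> circ_base X R" for S T
    unfolding arbitrary_union_of_alt using circ_base_Int[OF assms that] by (simp add: Bex_def)
  then have "istopology (arbitrary union_of (\<lambda>U. U \<in> circ_base X R))"
    by (simp add: istopology_base_eq)
  then show ?thesis
    by (simp add: circ_topology_def topology_inverse')
qed

lemma topspace_circ_topology:
  assumes "circular_order_on X R"
  shows "topspace (circ_topology X R) = X"
proof (rule antisym)
  show "topspace (circ_topology X R) \<subseteq> X"
    unfolding topspace_def openin_circ_topology[OF assms]
    by (auto simp: arbitrary_union_of_alt circ_base_def)
  have "openin (circ_topology X R) X"
    unfolding openin_circ_topology[OF assms]
    by (rule union_of_inc) (simp_all add: arbitrary_def circ_base_def)
  then show "X \<subseteq> topspace (circ_topology X R)"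
    by (rule openin_subset)
qed

section \<open>Linear orders\<close>

text \<open>
  Linear orders are reflexive relations \<open>r\<close> with \<^term>\<open>linear_order_on X r\<close>. The whole set is
  added to the open rays because a one-point set has only empty rays.
\<close>

definition lin_topology :: "'a set \<Rightarrow> ('a \<times> 'a) set \<Rightarrow> 'a topology" where
  "lin_topology X r = topology_generated_by
     ({{x \<in> X. (a, x) \<in> r \<and> x \<noteq> a} | a. a \<in> X} \<union>
      {{x \<in> X. (x, a) \<in> r \<and> x \<noteq> a} | a. a \<in> X} \<union> {X})"

section \<open>Generalized ordered topological spaces\<close>

text \<open>
  HOL cannot quantify over the type of the ambient ordered space \<open>Y\<close> inside a formula, so that
  type is an explicit parameter. A theorem having \<open>GCOTS TYPE('y) X R \<tau>\<close> as a hypothesis,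
  with \<open>'y\<close> a free type variable, covers ambient spaces of every type.
\<close>

definition GCOTS :: "'y itself \<Rightarrow> 'x set \<Rightarrow> ('x \<times> 'x \<times> 'x) set \<Rightarrow> 'x topology \<Rightarrow> bool" where
  "GCOTS ty X R \<tau> \<longleftrightarrow>
     circular_order_on X R \<and> topspace \<tau> = X \<and>
     (\<exists>(Y :: 'y set) S i.
        circular_order_on Y S \<and> inj_on i X \<and> embedding_map \<tau> (circ_topology Y S) i \<and>
        (\<forall>a\<in>X. \<forall>b\<in>X. \<forall>c\<in>X. (a, b, c) \<in> R \<longleftrightarrow> (i a, i b, i c) \<in> S))"

definition GLOTS :: "'y itself \<Rightarrow> 'x set \<Rightarrow> ('x \<times> 'x) set \<Rightarrow> 'x topology \<Rightarrow> bool" where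
  "GLOTS ty X r \<tau> \<longleftrightarrow>
     linear_order_on X r \<and> topspace \<tau> = X \<and>
     (\<exists>(Y :: 'y set) s i.
        linear_order_on Y s \<and> inj_on i X \<and> embedding_map \<tau> (lin_topology Y s) i \<and>
        (\<forall>a\<in>X. \<forall>b\<in>X. (a, b) \<in> r \<longleftrightarrow> (i a, i b) \<in> s))"

section \<open>Order preserving maps\<close>

definition COP :: "'a set \<Rightarrow> ('a \<times> 'a \<times> 'a) set \<Rightarrow> 'b set \<Rightarrow> ('b \<times> 'b \<times> 'b) set \<Rightarrow>
    ('a \<Rightarrow> 'b) \<Rightarrow> bool" where
  "COP X\<^sub>1 R\<^sub>1 X\<^sub>2 R\<^sub>2 f \<longleftrightarrow>
     f \<in> X\<^sub>1 \<rightarrow> X\<^sub>2 \<and>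
     (\<forall>a b c. (a, b, c) \<in> R\<^sub>1 \<and> f a \<noteq> f b \<and> f b \<noteq> f c \<and> f a \<noteq> f c \<longrightarrow>
        (f a, f b, f c) \<in> R\<^sub>2) \<and>
     (\<forall>x\<in>X\<^sub>1. \<forall>y\<in>X\<^sub>1. f x = f y \<longrightarrow>
        f constant_on circ_closed_interval R\<^sub>1 x y \<or> f constant_on circ_closed_interval R\<^sub>1 y x)"

definition LOP :: "'a set \<Rightarrow> ('a \<times> 'a) set \<Rightarrow> 'b set \<Rightarrow> ('b \<times> 'b) set \<Rightarrow> ('a \<Rightarrow> 'b) \<Rightarrow> bool" where
  "LOP X\<^sub>1 r\<^sub>1 X\<^sub>2 r\<^sub>2 f \<longleftrightarrow>
     f \<in> X\<^sub>1 \<rightarrow> X\<^sub>2 \<and>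
     (\<forall>x\<in>X\<^sub>1. \<forall>y\<in>X\<^sub>1. (x, y) \<in> r\<^sub>1 \<longrightarrow> (f x, f y) \<in> r\<^sub>2)"

section \<open>Semitopological groups and continuity of actions\<close>

definition semitopological_group :: "('g, 'm) monoid_scheme \<Rightarrow> 'g topology \<Rightarrow> bool" where
  "semitopological_group G T \<longleftrightarrow>
     group G \<and> topspace T = carrier G \<and> Hausdorff_space T \<and>
     (\<forall>g\<in>carrier G. continuous_map T T (\<lambda>h. g \<otimes>\<^bsub>G\<^esub> h)) \<and>
     (\<forall>g\<in>carrier G. continuous_map T T (\<lambda>h. h \<otimes>\<^bsub>G\<^esub> g))"

definition separately_continuous_action ::
    "('g, 'm) monoid_scheme \<Rightarrow> 'g topology \<Rightarrow> 'x set \<Rightarrow> 'x topology \<Rightarrow> ('g \<Rightarrow> 'x \<Rightarrow> 'x) \<Rightarrow> bool" where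
  "separately_continuous_action G T X \<tau> \<pi> \<longleftrightarrow>
     group_action G X \<pi> \<and>
     (\<forall>g\<in>carrier G. continuous_map \<tau> \<tau> (\<pi> g)) \<and>
     (\<forall>x\<in>X. continuous_map T \<tau> (\<lambda>g. \<pi> g x))"

end

theory Submission
  imports Defs
begin

text \<open>Translating in the group reduces joint continuity to continuity at the pairs
  \<open>(1, x)\<close> (\<open>openin_action_vimage\<close>), and \<open>X\<close> carries the
  topology induced by the ambient ordered space, so only preimages of rays or of basic open sets of
  that space have to be examined (\<open>continuous_map_into_embedding\<close>). Near
  \<open>(1, x)\<close> monotonicity turns separate into joint continuity: a neighbourhood of
  \<open>x\<close> is bounded by finitely many points of \<open>X\<close>, continuity of the orbit
  maps keeps these bounds inside the target for all \<open>g\<close> near \<open>1\<close>, and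
  \<open>g\<close> carries every point of the neighbourhood to the correct side of the moved bounds.
  For a ray in a linear order a single bound suffices (\<open>openin_action_vimage_above\<close>).
  On a circle two bounds \<open>y\<close> and \<open>z\<close> are needed. After cutting the circle
  at a point \<open>a\<close> outside the target, \<open>gy\<close> must moreover stay below
  \<open>gz\<close>: otherwise the arc from \<open>gy\<close> to \<open>gz\<close> would run through
  the cut. That order is stable under small perturbations by \<open>circ_cut_separation\<close>, and
  the squeeze is carried out in \<open>openin_action_vimage_circ\<close>.\<close>

section \<open>Reduction to the identity of the group and to the ambient space\<close>

text \<open>Since \<open>k w = (k g^-1)(g w)\<close>, a neighbourhood of \<open>(g, x)\<close>
  arises from one of \<open>(1, g x)\<close> by pulling back along right multiplication by
  \<open>g^-1\<close> and along \<open>\<pi> g\<close>, both of which are continuous.\<close>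

lemma openin_action_vimage:
  assumes G: "semitopological_group G T"
    and \<pi>: "separately_continuous_action G T X \<tau> \<pi>"
    and X: "topspace \<tau> = X"
    and at_one: "\<And>x. x \<in> X \<Longrightarrow> x \<in> U \<Longrightarrow> \<exists>N W. openin T N \<and> \<one>\<^bsub>G\<^esub> \<in> N \<and> openin \<tau> W \<and> x \<in> W \<and>
       (\<forall>h\<in>N. \<forall>w\<in>W. \<pi> h w \<in> U)"
  shows "openin (prod_topology T \<tau>) {p \<in> carrier G \<times> X. \<pi> (fst p) (snd p) \<in> U}"
  unfolding openin_prod_topology_alt
proof (intro allI impI)
  fix g x
  assume gx: "(g, x) \<in> {p \<in> carrier G \<times> X. \<pi> (fst p) (snd p) \<in> U}"
  interpret group_action G X \<pi>
    using \<pi> by (simp add: separately_continuous_action_def)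
  interpret group G
    using G by (simp add: semitopological_group_def)
  have T: "topspace T = carrier G"
    using G by (simp add: semitopological_group_def)
  have g: "g \<in> carrier G" and x: "x \<in> X" and U: "\<pi> g x \<in> U"
    using gx by auto
  have "\<pi> g x \<in> X"
    using element_image g x by blast
  from at_one[OF this U] obtain N W where N: "openin T N" "\<one>\<^bsub>G\<^esub> \<in> N"
    and W: "openin \<tau> W" "\<pi> g x \<in> W" and NW: "\<And>h w. h \<in> N \<Longrightarrow> w \<in> W \<Longrightarrow> \<pi> h w \<in> U"
    by blast
  let ?N = "{k \<in> carrier G. k \<otimes>\<^bsub>G\<^esub> inv\<^bsub>G\<^esub> g \<in> N}" and ?W = "{w \<in> X. \<pi> g w \<in> W}"
  have "continuous_map T T (\<lambda>h. h \<otimes>\<^bsub>G\<^esub> inv\<^bsub>G\<^esub> g)"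
    using G g by (simp add: semitopological_group_def)
  from openin_continuous_map_preimage[OF this N(1)] have "openin T ?N"
    by (simp add: T)
  moreover have "continuous_map \<tau> \<tau> (\<pi> g)"
    using \<pi> g by (simp add: separately_continuous_action_def)
  from openin_continuous_map_preimage[OF this W(1)] have "openin \<tau> ?W"
    by (simp add: X)
  moreover have "g \<in> ?N" "x \<in> ?W"
    using g x N W by auto
  moreover have "\<pi> k w \<in> U" if k: "k \<in> ?N" and w: "w \<in> ?W" for k w
  proof -
    have "\<pi> (k \<otimes>\<^bsub>G\<^esub> inv\<^bsub>G\<^esub> g) (\<pi> g w) = \<pi> (k \<otimes>\<^bsub>G\<^esub> inv\<^bsub>G\<^esub> g \<otimes>\<^bsub>G\<^esub> g) w"
      using k w g by (subst composition_rule) auto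
    also have "k \<otimes>\<^bsub>G\<^esub> inv\<^bsub>G\<^esub> g \<otimes>\<^bsub>G\<^esub> g = k"
      using k g by (simp add: m_assoc)
    finally show ?thesis
      using NW[of "k \<otimes>\<^bsub>G\<^esub> inv\<^bsub>G\<^esub> g" "\<pi> g w"] k w by simp
  qed
  ultimately show "\<exists>V W. openin T V \<and> openin \<tau> W \<and> g \<in> V \<and> x \<in> W \<and>
      V \<times> W \<subseteq> {p \<in> carrier G \<times> X. \<pi> (fst p) (snd p) \<in> U}"
    by (intro exI[of _ ?N] exI[of _ ?W]) auto
qed

lemma openin_orbit_vimage:
  assumes "semitopological_group G T" "separately_continuous_action G T X \<tau> \<pi>"
    and "x \<in> X" "openin \<tau> U"
  shows "openin T {g \<in> carrier G. \<pi> g x \<in> U}"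
proof -
  have "topspace T = carrier G" "continuous_map T \<tau> (\<lambda>g. \<pi> g x)"
    using assms by (auto simp: semitopological_group_def separately_continuous_action_def)
  then show ?thesis
    using openin_continuous_map_preimage[of T \<tau> "\<lambda>g. \<pi> g x" U] assms by simp
qed

text \<open>Corestrict \<open>i \<circ> f\<close> to the image of \<open>i\<close> and compose with
  the inverse homeomorphism \<open>j\<close>.\<close>

lemma continuous_map_into_embedding:
  assumes i: "embedding_map Y Z i" and f: "f \<in> topspace X \<rightarrow> topspace Y"
    and c: "continuous_map X Z (i \<circ> f)"
  shows "continuous_map X Y f"
proof -
  obtain j where j: "homeomorphic_maps Y (subtopology Z (i ` topspace Y)) i j"
    using i unfolding embedding_map_def homeomorphic_map_maps by blast
  have "continuous_map X (subtopology Z (i ` topspace Y)) (i \<circ> f)"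
    using c f by (intro continuous_map_into_subtopology) auto
  moreover have "continuous_map (subtopology Z (i ` topspace Y)) Y j"
    using j by (simp add: homeomorphic_maps_def)
  ultimately have "continuous_map X Y (j \<circ> (i \<circ> f))"
    by (rule continuous_map_compose)
  then show ?thesis
    by (rule continuous_map_eq) (use j f in \<open>auto simp: homeomorphic_maps_def Pi_iff\<close>)
qed

section \<open>Linear orders\<close>

text \<open>Reversing the order exchanges upper and lower rays, so lower rays can be treated by
  applying the result on upper rays to the converse relations.\<close>

lemma lin_topology_converse: "lin_topology Y (s\<inverse>) = lin_topology Y s"
  unfolding lin_topology_def by (simp add: Un_commute)

lemma LOP_converse: "LOP X (r\<inverse>) X' (r'\<inverse>) f \<longleftrightarrow> LOP X r X' r' f"
  by (auto simp: LOP_def)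

lemma openin_lin_topology_above:
  assumes "a \<in> Y"
  shows "openin (lin_topology Y s) {x \<in> Y. (a, x) \<in> s \<and> x \<noteq> a}"
  unfolding lin_topology_def using assms by (intro topology_generated_by_Basis) blast

text \<open>If \<open>U\<close> contains a point \<open>y\<close> of \<open>X\<close> below \<open>x\<close>, then \<open>g z > g y \<in> U\<close> for all \<open>z > y\<close>
  and all \<open>g\<close> near the identity; otherwise \<open>U\<close> itself lies above \<open>y = x\<close>.\<close>
lemma openin_action_vimage_above:
  assumes G: "semitopological_group G T"
    and \<pi>: "separately_continuous_action G T X \<tau> \<pi>"
    and X: "topspace \<tau> = X"
    and LOP: "\<And>g. g \<in> carrier G \<Longrightarrow> LOP X r X r (\<pi> g)"
    and s: "linear_order_on Y s"
    and i: "continuous_map \<tau> (lin_topology Y s) i" "i \<in> X \<rightarrow> Y"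
    and rs: "\<And>a b. a \<in> X \<Longrightarrow> b \<in> X \<Longrightarrow> (a, b) \<in> r \<longleftrightarrow> (i a, i b) \<in> s"
    and a: "a \<in> Y"
  shows "openin (prod_topology T \<tau>)
    {p \<in> carrier G \<times> X. \<pi> (fst p) (snd p) \<in> {x. (a, i x) \<in> s \<and> i x \<noteq> a}}"
proof (rule openin_action_vimage[OF G \<pi> X])
  fix x assume x: "x \<in> X" and "x \<in> {x. (a, i x) \<in> s \<and> i x \<noteq> a}"
  then have ax: "(a, i x) \<in> s" "i x \<noteq> a"
    by auto
  interpret group_action G X \<pi>
    using \<pi> by (simp add: separately_continuous_action_def)
  have s': "trans s" "antisym s" "refl_on Y s" "total_on Y s"
    using s by (simp_all add: order_on_defs)
  have trans: "(p, r) \<in> s" if "(p, q) \<in> s" "(q, r) \<in> s" for p q r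
    using transD[OF s'(1)] that .
  have antisym: "p = q" if "(p, q) \<in> s" "(q, p) \<in> s" for p q
    using antisymD[OF s'(2)] that .
  have total: "(p, q) \<in> s \<or> (q, p) \<in> s" if "p \<in> Y" "q \<in> Y" for p q
    using s'(3,4) that unfolding total_on_def refl_on_def by metis
  define A where "A = (\<lambda>b. {x \<in> X. (b, i x) \<in> s \<and> i x \<noteq> b})"
  have A: "openin \<tau> (A b)" if "b \<in> Y" for b
  proof -
    have "A b = {x \<in> X. i x \<in> {y \<in> Y. (b, y) \<in> s \<and> y \<noteq> b}}"
      using i(2) by (auto simp: A_def)
    then show ?thesis
      using openin_continuous_map_preimage[OF i(1) openin_lin_topology_above[OF that]] X by simp
  qed
  obtain y W where y: "y \<in> A a" and W: "openin \<tau> W" "x \<in> W" "\<And>w. w \<in> W \<Longrightarrow> w \<in> X \<and> (i y, i w) \<in> s"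
  proof (cases "\<exists>y\<in>A a. (i y, i x) \<in> s \<and> i y \<noteq> i x")
    case True
    then obtain y where "y \<in> A a" "(i y, i x) \<in> s" "i y \<noteq> i x"
      by blast
    with x i(2) show thesis
      by (intro that[of y "A (i y)"] A) (auto simp: A_def)
  next
    case False
    \<comment> \<open>By totality: no point of \<open>A a\<close> lies strictly below
      \<open>x\<close>.\<close>
    have "(i x, i w) \<in> s" if "w \<in> A a" for w
      using False that total[of "i x" "i w"] total[of "i x" "i x"] x i(2) by (force simp: A_def)
    with x ax show thesis
      by (intro that[of x "A a"] A a) (auto simp: A_def)
  qed
  let ?N = "{g \<in> carrier G. \<pi> g y \<in> A a}"
  have yX: "y \<in> X"
    using y by (simp add: A_def)
  have "openin T ?N"
    using openin_orbit_vimage[OF G \<pi> yX A[OF a]] .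
  \<comment> \<open>The unit acts as the identity function restricted to \<open>X\<close>, so it
    fixes \<open>y\<close>.\<close>
  moreover have "\<one>\<^bsub>G\<^esub> \<in> ?N"
    using id_eq_one[symmetric] G y yX unfolding semitopological_group_def group_def monoid_def
    by (auto simp: restrict_def)
  moreover have "\<pi> g w \<in> {x. (a, i x) \<in> s \<and> i x \<noteq> a}" if g: "g \<in> ?N" and w: "w \<in> W" for g w
  proof -
    have "w \<in> X" "(y, w) \<in> r"
      using W(3)[OF w] yX rs by auto
    then have "(\<pi> g y, \<pi> g w) \<in> r" "\<pi> g w \<in> X" "\<pi> g y \<in> X"
      using LOP[of g] g yX by (auto simp: LOP_def)
    then have "(i (\<pi> g y), i (\<pi> g w)) \<in> s"
      using rs by blast
    moreover have "(a, i (\<pi> g y)) \<in> s" "i (\<pi> g y) \<noteq> a"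
      using g by (auto simp: A_def)
    ultimately show ?thesis
      using trans antisym by blast
  qed
  ultimately show "\<exists>N W. openin T N \<and> \<one>\<^bsub>G\<^esub> \<in> N \<and> openin \<tau> W \<and> x \<in> W \<and>
       (\<forall>h\<in>N. \<forall>w\<in>W. \<pi> h w \<in> {x. (a, i x) \<in> s \<and> i x \<noteq> a})"
    using W(1,2) by blast
qed

lemma GLOTS_action_continuous:
  assumes G: "semitopological_group G T"
    and \<pi>: "separately_continuous_action G T X \<tau> \<pi>"
    and X: "GLOTS TYPE('z) X r \<tau>"
    and LOP: "\<And>g. g \<in> carrier G \<Longrightarrow> LOP X r X r (\<pi> g)"
  shows "continuous_map (prod_topology T \<tau>) \<tau> (\<lambda>(g, x). \<pi> g x)"
proof -
  obtain Y :: "'z set" and s i where s: "linear_order_on Y s"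
    and i: "embedding_map \<tau> (lin_topology Y s) i"
    and rs: "\<And>a b. a \<in> X \<Longrightarrow> b \<in> X \<Longrightarrow> (a, b) \<in> r \<longleftrightarrow> (i a, i b) \<in> s"
    and \<tau>: "topspace \<tau> = X"
    using X unfolding GLOTS_def by metis
  interpret group_action G X \<pi>
    using \<pi> by (simp add: separately_continuous_action_def)
  have ic: "continuous_map \<tau> (lin_topology Y s) i"
    using i by (auto simp: embedding_map_def continuous_map_in_subtopology dest: homeomorphic_imp_continuous_map)
  have "topspace (lin_topology Y s) = Y"
    unfolding lin_topology_def topology_generated_by_topspace by blast
  then have iY: "i \<in> X \<rightarrow> Y"
    using continuous_map_funspace[OF ic] \<tau> by simp
  have T: "topspace (prod_topology T \<tau>) = carrier G \<times> X"
    using G \<tau> by (simp add: semitopological_group_def)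
  have m: "(\<lambda>(g, x). \<pi> g x) \<in> carrier G \<times> X \<rightarrow> X"
    using element_image by auto
  \<comment> \<open>This brings preimages under the composite map into the form produced by
    \<open>openin_action_vimage_above\<close>; \<open>P\<close> ranges over both kinds of ray and
    the constant \<open>True\<close>.\<close>
  have iff: "(i \<circ> (\<lambda>(g, x). \<pi> g x)) -` {y \<in> Y. P y} \<inter> (carrier G \<times> X) =
    {p \<in> carrier G \<times> X. \<pi> (fst p) (snd p) \<in> {x. P (i x)}}" for P
    using m iY by (auto simp: Pi_iff)
  have above: "openin (prod_topology T \<tau>)
      {p \<in> carrier G \<times> X. \<pi> (fst p) (snd p) \<in> {x. (a, i x) \<in> s \<and> i x \<noteq> a}}"
    and below: "openin (prod_topology T \<tau>)
      {p \<in> carrier G \<times> X. \<pi> (fst p) (snd p) \<in> {x. (i x, a) \<in> s \<and> i x \<noteq> a}}"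
    if "a \<in> Y" for a
  proof -
    show "openin (prod_topology T \<tau>)
      {p \<in> carrier G \<times> X. \<pi> (fst p) (snd p) \<in> {x. (a, i x) \<in> s \<and> i x \<noteq> a}}"
      by (rule openin_action_vimage_above[OF G \<pi> \<tau> LOP s ic iY rs that])
    \<comment> \<open>Lower rays: all hypotheses are invariant under reversing \<open>r\<close> and
      \<open>s\<close> together.\<close>
    have "LOP X (r\<inverse>) X (r\<inverse>) (\<pi> g)" if "g \<in> carrier G" for g
      using LOP[OF that] by (simp add: LOP_converse)
    moreover have "linear_order_on Y (s\<inverse>)"
      using s by simp
    moreover have "continuous_map \<tau> (lin_topology Y (s\<inverse>)) i"
      using ic by (simp add: lin_topology_converse)
    moreover have "(a, b) \<in> r\<inverse> \<longleftrightarrow> (i a, i b) \<in> s\<inverse>" if "a \<in> X" "b \<in> X" for a b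
      using rs that by simp
    ultimately have "openin (prod_topology T \<tau>)
      {p \<in> carrier G \<times> X. \<pi> (fst p) (snd p) \<in> {x. (a, i x) \<in> s\<inverse> \<and> i x \<noteq> a}}"
      using openin_action_vimage_above[OF G \<pi> \<tau>, of "r\<inverse>" Y "s\<inverse>" i a] iY \<open>a \<in> Y\<close> by blast
    then show "openin (prod_topology T \<tau>)
      {p \<in> carrier G \<times> X. \<pi> (fst p) (snd p) \<in> {x. (i x, a) \<in> s \<and> i x \<noteq> a}}"
      by simp
  qed
  have whole: "openin (prod_topology T \<tau>) {p \<in> carrier G \<times> X. \<pi> (fst p) (snd p) \<in> {x. True}}"
    using openin_topspace[of "prod_topology T \<tau>"] unfolding T by simp
  have "continuous_map (prod_topology T \<tau>) (lin_topology Y s) (i \<circ> (\<lambda>(g, x). \<pi> g x))"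
    unfolding lin_topology_def continuous_on_generated_topo_iff T
  proof (intro conjI allI impI)
    show "(i \<circ> (\<lambda>(g, x). \<pi> g x)) ` (carrier G \<times> X) \<subseteq>
        \<Union> ({{x \<in> Y. (a, x) \<in> s \<and> x \<noteq> a} |a. a \<in> Y} \<union> {{x \<in> Y. (x, a) \<in> s \<and> x \<noteq> a} |a. a \<in> Y} \<union> {Y})"
      using m iY by (auto simp: Pi_iff)
    fix U
    assume "U \<in> {{x \<in> Y. (a, x) \<in> s \<and> x \<noteq> a} |a. a \<in> Y} \<union> {{x \<in> Y. (x, a) \<in> s \<and> x \<noteq> a} |a. a \<in> Y} \<union> {Y}"
    then consider a where "a \<in> Y" "U = {x \<in> Y. (a, x) \<in> s \<and> x \<noteq> a}"
      | a where "a \<in> Y" "U = {x \<in> Y. (x, a) \<in> s \<and> x \<noteq> a}" | "U = {x \<in> Y. True}"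
      by (elim UnE CollectE exE conjE) simp_all
    then show "openin (prod_topology T \<tau>) ((i \<circ> (\<lambda>(g, x). \<pi> g x)) -` U \<inter> carrier G \<times> X)"
      using above below whole by cases (simp_all only: iff)
  qed
  with m show ?thesis
    by (intro continuous_map_into_embedding[OF i]) (simp_all only: T \<tau>)
qed

section \<open>Circular orders and cutting the circle at a point\<close>

context
  fixes Y :: "'a set" and S :: "('a \<times> 'a \<times> 'a) set"
  assumes S: "circular_order_on Y S"
begin

lemma circ_cyc: "(a, b, c) \<in> S \<Longrightarrow> (b, c, a) \<in> S"
  using S unfolding circular_order_on_def by iprover

lemma circ_asym: "(a, b, c) \<in> S \<Longrightarrow> (c, b, a) \<notin> S"
  using S unfolding circular_order_on_def by iprover

lemma circ_trans: "(a, b, c) \<in> S \<Longrightarrow> (a, c, d) \<in> S \<Longrightarrow> (a, b, d) \<in> S"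
  using S unfolding circular_order_on_def by iprover

lemma circ_total:
  "\<lbrakk>a \<in> Y; b \<in> Y; c \<in> Y; a \<noteq> b; b \<noteq> c; a \<noteq> c\<rbrakk> \<Longrightarrow> (a, b, c) \<in> S \<or> (a, c, b) \<in> S"
  using S unfolding circular_order_on_def by blast

lemma circ_carrier: "(a, b, c) \<in> S \<Longrightarrow> a \<in> Y \<and> b \<in> Y \<and> c \<in> Y"
  using S[unfolded circular_order_on_def, THEN conjunct1] by auto

lemma circ_distinct: "(a, b, c) \<in> S \<Longrightarrow> a \<noteq> b \<and> b \<noteq> c \<and> a \<noteq> c"
  using circ_cyc circ_asym by metis

text \<open>Cutting at \<open>a\<close> makes \<open>(a, u, v) \<in> S\<close> a strict linear order
  on \<open>Y - {a}\<close>. If \<open>p\<close> precedes \<open>q\<close> there, the arc from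
  \<open>p\<close> to \<open>q\<close> avoids the cut and is the ordinary interval between
  them.\<close>

lemma circ_between_iff:
  assumes "(a, p, q) \<in> S"
  shows "(p, u, q) \<in> S \<longleftrightarrow> (a, p, u) \<in> S \<and> (a, u, q) \<in> S"
proof
  assume u: "(p, u, q) \<in> S"
  have "(q, a, u) \<in> S"
    using circ_trans[OF circ_cyc[OF circ_cyc[OF assms]] circ_cyc[OF circ_cyc[OF u]]] .
  moreover have "(p, u, a) \<in> S"
    using circ_trans[OF u circ_cyc[OF assms]] .
  ultimately show "(a, p, u) \<in> S \<and> (a, u, q) \<in> S"
    using circ_cyc by blast
next
  assume u: "(a, p, u) \<in> S \<and> (a, u, q) \<in> S"
  have "(u, q, p) \<in> S"
    by (rule circ_trans[of u q a p]) (use u circ_cyc in blast)+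
  then show "(p, u, q) \<in> S"
    using circ_cyc by blast
qed

text \<open>By totality, a point off the closed arc from \<open>a\<close> to \<open>b\<close> lies
  inside the complementary arc. For \<open>a = b\<close> the left side is \<open>Y - {a}\<close>,
  whereas \<open>{u. (a, u, a) \<in> S}\<close> is empty.\<close>

lemma Diff_circ_closed_interval:
  assumes "a \<in> Y" "b \<in> Y" "a \<noteq> b"
  shows "Y - circ_closed_interval S a b = {u. (b, u, a) \<in> S}"
proof -
  have "u \<notin> circ_closed_interval S a b \<longleftrightarrow> (b, u, a) \<in> S" if "u \<in> Y" for u
    unfolding circ_closed_interval_def circ_open_interval_def
    using circ_total[of b u a] circ_cyc circ_asym[of b u a] circ_distinct[of b u a] assms that
    by auto
  then show ?thesis
    using circ_carrier by blast
qed

lemma openin_circ_base: "U \<in> circ_base Y S \<Longrightarrow> openin (circ_topology Y S) U"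
  unfolding openin_circ_topology[OF S] by (rule union_of_inc) (simp_all add: arbitrary_def)

lemma openin_circ_open_interval: "openin (circ_topology Y S) {u. (a, u, b) \<in> S}"
proof (cases "a \<in> Y \<and> b \<in> Y \<and> a \<noteq> b")
  case True
  then have "{u. (a, u, b) \<in> S} \<in> circ_base Y S"
    using Diff_circ_closed_interval[of b a] unfolding circ_base_def by blast
  then show ?thesis
    by (rule openin_circ_base)
next
  case False
  then have "{u. (a, u, b) \<in> S} = {}"
    using circ_carrier circ_distinct by blast
  then show ?thesis
    by simp
qed

text \<open>The order of two points on the line cut at \<open>a\<close> persists under small
  perturbations. If some \<open>z\<close> lies strictly between them, the rays below and above
  \<open>z\<close> separate; if \<open>p\<close> and \<open>q\<close> are neighbours, the rays below
  \<open>q\<close> and above \<open>p\<close> do.\<close>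

lemma circ_cut_separation:
  assumes "(a, p, q) \<in> S"
  obtains P Q where "openin (circ_topology Y S) P" "openin (circ_topology Y S) Q" "p \<in> P" "q \<in> Q"
    "\<And>u v. u \<in> P \<Longrightarrow> v \<in> Q \<Longrightarrow> (a, u, v) \<in> S"
proof (cases "\<exists>z. (a, p, z) \<in> S \<and> (a, z, q) \<in> S")
  case True
  then obtain z where z: "(a, p, z) \<in> S" "(a, z, q) \<in> S"
    by blast
  show thesis
  proof (rule that)
    show "openin (circ_topology Y S) {u. (a, u, z) \<in> S}" "openin (circ_topology Y S) {u. (z, u, a) \<in> S}"
      by (rule openin_circ_open_interval)+
    show "p \<in> {u. (a, u, z) \<in> S}" "q \<in> {u. (z, u, a) \<in> S}"
      using z circ_cyc by auto
    show "(a, u, v) \<in> S" if "u \<in> {u. (a, u, z) \<in> S}" "v \<in> {u. (z, u, a) \<in> S}" for u v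
      using that circ_trans[of a u z v] circ_cyc by blast
  qed
next
  case False
  show thesis
  proof (rule that)
    show "openin (circ_topology Y S) {u. (a, u, q) \<in> S}" "openin (circ_topology Y S) {u. (p, u, a) \<in> S}"
      by (rule openin_circ_open_interval)+
    show "p \<in> {u. (a, u, q) \<in> S}" "q \<in> {u. (p, u, a) \<in> S}"
      using assms circ_cyc by auto
    show "(a, u, v) \<in> S" if "u \<in> {u. (a, u, q) \<in> S}" "v \<in> {u. (p, u, a) \<in> S}" for u v
    proof -
      have u: "(a, u, q) \<in> S" and v: "(a, p, v) \<in> S"
        using that circ_cyc by blast+
      \<comment> \<open>Otherwise \<open>u\<close> would lie strictly between \<open>p\<close> and
        \<open>q\<close>.\<close>
      have "u = p \<or> (a, u, p) \<in> S"
        using False u circ_total[of a u p] circ_carrier[OF u] circ_carrier[OF v]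
          circ_distinct[OF u] circ_distinct[OF v] by blast
      then show ?thesis
        using v circ_trans by blast
    qed
  qed
qed

end

section \<open>Circular order preserving actions\<close>

text \<open>Entries of a triple in \<open>R\<close> are distinct and stay so under an injective map,
  so (COP1) applies unconditionally. Translations of a group action are injective.\<close>

lemma COP_inj_preserves:
  assumes "COP X R X' R' f" "inj_on f X" "circular_order_on X R" "(a, b, c) \<in> R"
  shows "(f a, f b, f c) \<in> R'"
proof -
  have "f a \<noteq> f b \<and> f b \<noteq> f c \<and> f a \<noteq> f c"
    using circ_carrier[OF assms(3,4)] circ_distinct[OF assms(3,4)] assms(2) by (auto dest: inj_onD)
  then show ?thesis
    using assms(1,4) unfolding COP_def by blast
qed

text \<open>A basic neighbourhood \<open>Y - [a,b]\<close> is an upper ray of the linear order \<open>(a,u,v) \<in> S\<close> on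
  \<open>Y - {a}\<close> obtained by cutting the circle at \<open>a\<close>. In that order choose \<open>y \<le> x \<le> z\<close> in \<open>X\<close> such
  that \<open>x\<close> has a neighbourhood inside \<open>[y,z]\<close>. For \<open>g\<close> near the identity \<open>gy \<le> gz\<close> still lie in
  the ray, and order preservation places \<open>g[y,z]\<close> between them rather than around the other
  side of the circle.\<close>
lemma openin_action_vimage_circ:
  assumes G: "semitopological_group G T"
    and \<pi>: "separately_continuous_action G T X \<tau> \<pi>"
    and X: "topspace \<tau> = X"
    and R: "circular_order_on X R"
    and COP: "\<And>g. g \<in> carrier G \<Longrightarrow> COP X R X R (\<pi> g)"
    and S: "circular_order_on Y S"
    and i: "continuous_map \<tau> (circ_topology Y S) i" "i \<in> X \<rightarrow> Y" "inj_on i X"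
    and RS: "\<And>a b c. \<lbrakk>a \<in> X; b \<in> X; c \<in> X\<rbrakk> \<Longrightarrow> (a, b, c) \<in> R \<longleftrightarrow> (i a, i b, i c) \<in> S"
    and ab: "a \<in> Y" "b \<in> Y"
  shows "openin (prod_topology T \<tau>)
    {p \<in> carrier G \<times> X. \<pi> (fst p) (snd p) \<in> {x. i x \<in> Y - circ_closed_interval S a b}}"
proof (rule openin_action_vimage[OF G \<pi> X])
  interpret group_action G X \<pi>
    using \<pi> by (simp add: separately_continuous_action_def)
  note cyc = circ_cyc[OF S] and trans = circ_trans[OF S] and carr = circ_carrier[OF S]
    and dist = circ_distinct[OF S] and total = circ_total[OF S] and btw = circ_between_iff[OF S]
  define U where "U = {x \<in> X. i x \<in> Y - circ_closed_interval S a b}"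
  define above where "above = (\<lambda>p. {x \<in> X. (a, i p, i x) \<in> S})"
  define below where "below = (\<lambda>p. {x \<in> X. (a, i x, i p) \<in> S})"
  have preim: "openin \<tau> {x \<in> X. i x \<in> V}" if "openin (circ_topology Y S) V" for V
    using openin_continuous_map_preimage[OF i(1) that] X by simp
  have "Y - circ_closed_interval S a b \<in> circ_base Y S"
    unfolding circ_base_def using ab by blast
  then have "openin (circ_topology Y S) (Y - circ_closed_interval S a b)"
    by (rule openin_circ_base[OF S])
  then have U: "openin \<tau> U"
    unfolding U_def by (rule preim)
  have above: "openin \<tau> (above p)" for p
  proof -
    have "above p = {x \<in> X. i x \<in> {u. (i p, u, a) \<in> S}}"
      unfolding above_def using cyc by blast
    then show ?thesis
      using preim[OF openin_circ_open_interval[OF S]] by simp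
  qed
  have below: "openin \<tau> (below p)" for p
    using preim[OF openin_circ_open_interval[OF S, of a "i p"]] by (simp add: below_def)
  \<comment> \<open>On the line cut at \<open>a\<close>, \<open>U\<close> is the ray above
    \<open>b\<close>, or everything if \<open>a = b\<close>.\<close>
  have U_iff: "x \<in> U \<longleftrightarrow> x \<in> X \<and> i x \<noteq> a \<and> (a = b \<or> (a, b, i x) \<in> S)" for x
  proof (cases "a = b")
    case True
    then show ?thesis
      using dist[of a _ a] i(2) by (auto simp: U_def circ_closed_interval_def circ_open_interval_def)
  next
    case False
    show ?thesis
      using Diff_circ_closed_interval[OF S ab False] cyc dist False unfolding U_def by blast
  qed
  have lin: "p = q \<or> p \<in> below q \<or> p \<in> above q" if "p \<in> U" "q \<in> U" for p q
    using that total[of a "i p" "i q"] i(2) inj_onD[OF i(3)] ab unfolding U_iff below_def above_def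
    by blast
  fix x assume "x \<in> X" and "x \<in> {x. i x \<in> Y - circ_closed_interval S a b}"
  then have x: "x \<in> U"
    by (simp add: U_def)
  have UX: "u \<in> X" if "u \<in> U" for u
    using that by (simp add: U_def)
  have up: "w \<in> U" if "w \<in> above u" "u \<in> U" for u w
    using that trans[of a b "i u" "i w"] dist[of a "i u" "i w"] unfolding U_iff above_def by blast
  \<comment> \<open>Lower bound: a point of \<open>U\<close> below \<open>x\<close> if there is one;
    otherwise \<open>x\<close> is least in \<open>U\<close>, and \<open>y = x\<close> bounds all of
    \<open>U\<close>.\<close>
  obtain y V where y: "y \<in> U" "y = x \<or> y \<in> below x"
    and V: "openin \<tau> V" "x \<in> V" "\<And>w. w \<in> V \<Longrightarrow> w \<in> U \<and> (w = y \<or> w \<in> above y)"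
  proof (cases "\<exists>y\<in>U. y \<in> below x")
    case True
    then obtain y where y: "y \<in> U" "y \<in> below x"
      by blast
    then have "x \<in> above y"
      using UX[OF x] by (simp add: above_def below_def)
    with y up above show thesis
      by (intro that[of y "above y"]) auto
  next
    case False
    with x U lin show thesis
      by (intro that[of x U]) auto
  qed
  \<comment> \<open>Upper bound, by the same dichotomy. Points above \<open>x\<close> lie in
    \<open>U\<close> by \<open>up\<close>. The ray \<open>below z\<close> may leave
    \<open>U\<close>, so membership in \<open>U\<close> is left to \<open>V\<close>.\<close>
  obtain z W where z: "z \<in> U" "z = x \<or> z \<in> above x"
    and W: "openin \<tau> W" "x \<in> W" "\<And>w. w \<in> W \<Longrightarrow> w \<in> U \<Longrightarrow> w = z \<or> w \<in> below z"
  proof (cases "\<exists>z. z \<in> above x")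
    case True
    then obtain z where z: "z \<in> above x"
      by blast
    then have "x \<in> below z"
      using UX[OF x] by (simp add: above_def below_def)
    with z up[OF z x] below show thesis
      by (intro that[of z "below z"]) auto
  next
    case False
    with x U lin show thesis
      by (intro that[of x U]) auto
  qed
  have yz: "y = z \<or> (a, i y, i z) \<in> S"
    using y(2) z(2) trans unfolding above_def below_def by blast
  \<comment> \<open>\<open>NU\<close> alone would allow \<open>gy\<close> and \<open>gz\<close> to
    change places within \<open>U\<close>, sending the arc between them through \<open>a\<close>;
    \<open>Nlt\<close> excludes this.\<close>
  obtain N where N: "openin T N" "\<one>\<^bsub>G\<^esub> \<in> N" "N \<subseteq> carrier G"
    and NU: "\<And>g. g \<in> N \<Longrightarrow> \<pi> g y \<in> U \<and> \<pi> g z \<in> U"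
    and Nlt: "\<And>g. g \<in> N \<Longrightarrow> y = z \<or> (a, i (\<pi> g y), i (\<pi> g z)) \<in> S"
  proof -
    have one: "\<one>\<^bsub>G\<^esub> \<in> carrier G" "\<And>u. u \<in> U \<Longrightarrow> \<pi> \<one>\<^bsub>G\<^esub> u = u"
      using id_eq_one[symmetric] G UX unfolding semitopological_group_def group_def monoid_def
      by (auto simp: restrict_def)
    let ?N = "\<lambda>P Q. {g \<in> carrier G. \<pi> g y \<in> P} \<inter> {g \<in> carrier G. \<pi> g z \<in> Q}"
    have N: "openin T (?N P Q)" if "openin \<tau> P" "openin \<tau> Q" for P Q
      using openin_orbit_vimage[OF G \<pi>] UX y(1) z(1) that by blast
    show thesis
    proof (cases "y = z")
      case True
      show thesis
        by (rule that[of "?N U U"]) (use N[OF U U] one y z True in auto)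
    next
      case False
      then have "(a, i y, i z) \<in> S"
        using yz by simp
      from circ_cut_separation[OF S this] obtain P Q
        where P: "openin (circ_topology Y S) P" "i y \<in> P"
          and Q: "openin (circ_topology Y S) Q" "i z \<in> Q"
          and PQ: "\<And>u v. u \<in> P \<Longrightarrow> v \<in> Q \<Longrightarrow> (a, u, v) \<in> S"
        by metis
      let ?P = "U \<inter> {x \<in> X. i x \<in> P}" and ?Q = "U \<inter> {x \<in> X. i x \<in> Q}"
      have "openin \<tau> ?P" "openin \<tau> ?Q"
        using U preim P(1) Q(1) by blast+
      then show thesis
        by (intro that[of "?N ?P ?Q"] N) (use one y z P Q PQ UX in auto)
    qed
  qed
  have "i (\<pi> g w) \<in> Y - circ_closed_interval S a b" if g: "g \<in> N" and w: "w \<in> V \<inter> W" for g w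
  proof -
    have wU: "w \<in> U" and "w = y \<or> w \<in> above y" "w = z \<or> w \<in> below z"
      using V(3)[of w] W(3)[of w] w by auto
    \<comment> \<open>At the bounds themselves \<open>NU\<close> gives the claim; only a point
      strictly between them calls for order preservation.\<close>
    then consider "w = y" | "w = z" | "(a, i y, i w) \<in> S" "(a, i w, i z) \<in> S" "w \<noteq> y" "w \<noteq> z"
      unfolding above_def below_def by blast
    then have "\<pi> g w \<in> U"
    proof cases
      case 3
      then have "(a, i y, i z) \<in> S"
        using trans by blast
      then have "(i y, i w, i z) \<in> S" "y \<noteq> z"
        using btw 3 dist by blast+
      then have "(y, w, z) \<in> R"
        using RS UX y z wU by blast
      moreover have gG: "g \<in> carrier G"
        using g N by blast
      ultimately have "(\<pi> g y, \<pi> g w, \<pi> g z) \<in> R"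
        using COP_inj_preserves[OF COP inj_prop R] by blast
      moreover from this have "\<pi> g w \<in> X"
        using circ_carrier[OF R] by blast
      ultimately have "(i (\<pi> g y), i (\<pi> g w), i (\<pi> g z)) \<in> S"
        using RS NU[OF g] UX by blast
      \<comment> \<open>As \<open>gy\<close> precedes \<open>gz\<close> in the cut order, lying on
        the arc between them means lying above \<open>gy\<close>, hence in the ray
        \<open>U\<close>.\<close>
      then have "(a, i (\<pi> g y), i (\<pi> g w)) \<in> S"
        using btw Nlt[OF g] \<open>y \<noteq> z\<close> by blast
      then have "\<pi> g w \<in> above (\<pi> g y)"
        using \<open>\<pi> g w \<in> X\<close> by (simp add: above_def)
      then show ?thesis
        using up NU[OF g] by blast
    qed (use NU[OF g] in auto)
    then show ?thesis
      by (simp add: U_def)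
  qed
  then show "\<exists>N W. openin T N \<and> \<one>\<^bsub>G\<^esub> \<in> N \<and> openin \<tau> W \<and> x \<in> W \<and>
       (\<forall>h\<in>N. \<forall>w\<in>W. \<pi> h w \<in> {x. i x \<in> Y - circ_closed_interval S a b})"
    using N openin_Int[OF V(1) W(1)] V(2) W(2) by blast
qed

lemma GCOTS_action_continuous:
  assumes G: "semitopological_group G T"
    and \<pi>: "separately_continuous_action G T X \<tau> \<pi>"
    and X: "GCOTS TYPE('y) X R \<tau>"
    and COP: "\<And>g. g \<in> carrier G \<Longrightarrow> COP X R X R (\<pi> g)"
  shows "continuous_map (prod_topology T \<tau>) \<tau> (\<lambda>(g, x). \<pi> g x)"
proof -
  obtain Y :: "'y set" and S i where R: "circular_order_on X R" and S: "circular_order_on Y S"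
    and inj: "inj_on i X"
    and i: "embedding_map \<tau> (circ_topology Y S) i"
    and RS: "\<And>a b c. \<lbrakk>a \<in> X; b \<in> X; c \<in> X\<rbrakk> \<Longrightarrow> (a, b, c) \<in> R \<longleftrightarrow> (i a, i b, i c) \<in> S"
    and \<tau>: "topspace \<tau> = X"
    using X unfolding GCOTS_def by metis
  interpret group_action G X \<pi>
    using \<pi> by (simp add: separately_continuous_action_def)
  have ic: "continuous_map \<tau> (circ_topology Y S) i"
    using i by (auto simp: embedding_map_def continuous_map_in_subtopology dest: homeomorphic_imp_continuous_map)
  then have iY: "i \<in> X \<rightarrow> Y"
    using continuous_map_funspace \<tau> topspace_circ_topology[OF S] by metis
  have T: "topspace (prod_topology T \<tau>) = carrier G \<times> X"
    using G \<tau> by (simp add: semitopological_group_def)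
  have m: "(\<lambda>(g, x). \<pi> g x) \<in> carrier G \<times> X \<rightarrow> X"
    using element_image by auto
  have "continuous_map (prod_topology T \<tau>) (circ_topology Y S) (i \<circ> (\<lambda>(g, x). \<pi> g x))"
  proof (rule continuous_map_into_topology_base[OF openin_circ_topology[OF S]])
    show "(i \<circ> (\<lambda>(g, x). \<pi> g x)) p \<in> topspace (circ_topology Y S)"
      if "p \<in> topspace (prod_topology T \<tau>)" for p
      using that m iY unfolding T topspace_circ_topology[OF S] by (auto simp: Pi_iff)
    fix U assume "U \<in> circ_base Y S"
    then consider a b where "a \<in> Y" "b \<in> Y" "U = Y - circ_closed_interval S a b" | "U = Y"
      unfolding circ_base_def by blast
    then have "openin (prod_topology T \<tau>) {p \<in> carrier G \<times> X. \<pi> (fst p) (snd p) \<in> {x. i x \<in> U}}"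
    proof cases
      case 1
      then show ?thesis
        using openin_action_vimage_circ[OF G \<pi> \<tau> R COP S ic iY inj RS] by simp
    next
      case 2
      then have "{p \<in> carrier G \<times> X. \<pi> (fst p) (snd p) \<in> {x. i x \<in> U}} = topspace (prod_topology T \<tau>)"
        using m iY unfolding T by (auto simp: Pi_iff)
      then show ?thesis
        by (simp only: openin_topspace)
    qed
    then show "openin (prod_topology T \<tau>)
        {p \<in> topspace (prod_topology T \<tau>). (i \<circ> (\<lambda>(g, x). \<pi> g x)) p \<in> U}"
      unfolding T by (simp add: case_prod_unfold)
  qed
  with m show ?thesis
    by (intro continuous_map_into_embedding[OF i]) (simp_all only: T \<tau>)
qed

theorem theorem7p9:
  fixes G :: "('g, 'm) monoid_scheme" and T :: "'g topology"
    and X :: "'x set" and \<tau> :: "'x topology" and \<pi> :: "'g \<Rightarrow> 'x \<Rightarrow> 'x"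
    and R :: "('x \<times> 'x \<times> 'x) set" and r :: "('x \<times> 'x) set"
  assumes "semitopological_group G T"
    and "separately_continuous_action G T X \<tau> \<pi>"
  shows "(GCOTS TYPE('y) X R \<tau> \<and> (\<forall>g\<in>carrier G. COP X R X R (\<pi> g)) \<longrightarrow>
            continuous_map (prod_topology T \<tau>) \<tau> (\<lambda>(g, x). \<pi> g x)) \<and>
         (GLOTS TYPE('z) X r \<tau> \<and> (\<forall>g\<in>carrier G. LOP X r X r (\<pi> g)) \<longrightarrow>
            continuous_map (prod_topology T \<tau>) \<tau> (\<lambda>(g, x). \<pi> g x))"
  using GCOTS_action_continuous[OF assms] GLOTS_action_continuous[OF assms] by blast

end
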